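(* Let $\langle(p^{(t)},\Omega_t)\mid t\in\mathbb{N}^0\rangle$ be a linear dynamic optimization (LDO) problem on $X=[0,b]$, $b>0$. (i) The optimal value function $V=V^0$ is concave and continuous on $X$. (ii) For all $T\in\mathbb{N}^0$, $V^T$ is concave and continuous on $X$ and satisfies the functional equation of dynamic programming: for all $T\in\mathbb{N}^0$, $z\in X$ and $\langle x_t\mid t\ge T\rangle\in\mathcal{S}^T(z)$, $$V^T(z)=p^{(T)}z+V^{T+1}(x_{T+1})=p^{(T)}z+\max_{y\in\Omega_T(z)}V^{T+1}(y).$$ (iii) For all $x\in X$: $\langle x_t\mid t\in\mathbb{N}^0\rangle\in\mathcal{S}(x)$ if and only if $\langle x_t\mid t\in\mathbb{N}^0\rangle\in\mathcal{F}(x)$ and for all $T\in\mathbb{N}^0$ it is the case that $V^T(x_T)=p^{(T)}x_T+V^{T+1}(x_{T+1})$.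
   Context: $\mathbb{N}^0=\{0,1,2,\dots\}$. An LDO problem $\langle(p^{(t)},\Omega_t)\mid t\in\mathbb{N}^0\rangle$ on $X=[0,b]$ consists of a sequence of real numbers $p^{(t)}$ with $\sum_{t=0}^\infty|p^{(t)}|<+\infty$ and sets $\Omega_t\subset X\times X$ such that for every $t\in\mathbb{N}^0$: (i) $\Omega_t$ is non-empty, closed and convex; (ii) for every $x\in X$ there is $y\in X$ with $(x,y)\in\Omega_t$. Write $\Omega_t(x)=\{y\mid(x,y)\in\Omega_t\}$. For $T\in\mathbb{N}^0$ and $y\in X$, $\mathcal{F}^T(y)$ is the set of sequences $\langle x_t\mid t\ge T\rangle$ in $X$ with $x_T=y$ and $(x_t,x_{t+1})\in\Omega_t$ for all $t\ge T$; $\mathcal{S}^T(y)$ is the set of maximizers of $\sum_{t=T}^\infty p^{(t)}x_t$ over $\langle x_t\mid t\ge T\rangle\in\mathcal{F}^T(y)$. The set $\mathcal{S}^T(y)$ is non-empty for every $y\in X$, and $V^T:X\to\mathbb{R}$ is defined by $V^T(y)=\sum_{t=T}^\infty p^{(t)}x_t$ for any $\langle x_t\mid t\ge T\rangle\in\mathcal{S}^T(y)$ (the maximal value). For $T=0$ write $\mathcal{F}=\mathcal{F}^0$, $\mathcal{S}=\mathcal{S}^0$, $V=V^0$. *)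

theory Defs
  imports "HOL-Analysis.Analysis"
begin

definition LDO_problem :: "real \<Rightarrow> (nat \<Rightarrow> real) \<Rightarrow> (nat \<Rightarrow> (real \<times> real) set) \<Rightarrow> bool" where
  "LDO_problem b p \<Omega> \<longleftrightarrow>
     summable (\<lambda>t. \<bar>p t\<bar>) \<and>
     (\<forall>t. \<Omega> t \<subseteq> {0..b} \<times> {0..b} \<and>
          \<Omega> t \<noteq> {} \<and> closed (\<Omega> t) \<and> convex (\<Omega> t) \<and>
          (\<forall>x\<in>{0..b}. \<exists>y\<in>{0..b}. (x, y) \<in> \<Omega> t))"

text \<open>A sequence indexed by \<open>t \<ge> T\<close> is a function in the extensional function space over
  \<open>{T..}\<close>, so that its values below \<open>T\<close> carry no information. For \<open>T = 0\<close> this is an ordinary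
  function on the natural numbers.\<close>

definition feasible :: "real \<Rightarrow> (nat \<Rightarrow> (real \<times> real) set) \<Rightarrow> nat \<Rightarrow> real \<Rightarrow> (nat \<Rightarrow> real) set" where
  "feasible b \<Omega> T y =
     {x \<in> {T..} \<rightarrow>\<^sub>E {0..b}. x T = y \<and> (\<forall>t\<ge>T. (x t, x (Suc t)) \<in> \<Omega> t)}"

text \<open>The series \<open>\<Sum>t\<ge>T. p t * x t\<close>, reindexed to start at 0. It converges absolutely when \<open>p\<close> is
  absolutely summable and \<open>x\<close> is bounded.\<close>

definition objective :: "(nat \<Rightarrow> real) \<Rightarrow> nat \<Rightarrow> (nat \<Rightarrow> real) \<Rightarrow> real" where
  "objective p T x = (\<Sum>k. p (T + k) * x (T + k))"

definition solutions ::
  "real \<Rightarrow> (nat \<Rightarrow> real) \<Rightarrow> (nat \<Rightarrow> (real \<times> real) set) \<Rightarrow> nat \<Rightarrow> real \<Rightarrow> (nat \<Rightarrow> real) set" where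
  "solutions b p \<Omega> T y = {x. is_arg_max (objective p T) (\<lambda>x. x \<in> feasible b \<Omega> T y) x}"

text \<open>The common objective value of all maximizers. The description is proper because
  \<open>solutions b p \<Omega> T y\<close> is non-empty for every LDO problem and every \<open>y \<in> {0..b}\<close>.\<close>

definition opt_value ::
  "real \<Rightarrow> (nat \<Rightarrow> real) \<Rightarrow> (nat \<Rightarrow> (real \<times> real) set) \<Rightarrow> nat \<Rightarrow> real \<Rightarrow> real" where
  "opt_value b p \<Omega> T y = (THE v. \<exists>x\<in>solutions b p \<Omega> T y. v = objective p T x)"

end

(* Feasible trajectories form a compact set in the product topology, on which the objective is
   continuous by the Weierstrass M-test. Hence maximizers exist and the superlevel sets of V^T,
   being projections of compact sets, are closed: V^T is upper semicontinuous. Convexity of the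
   sets Omega_t makes V^T concave, and a concave function on a compact interval is automatically
   lower semicontinuous, also at the endpoints. The functional equation comes from cutting off or
   prepending the first term of a trajectory. Conversely, the functional equation along a
   trajectory telescopes, and the remainder V^T(x_T) tends to 0 because it is bounded by a tail of
   the absolutely convergent series of b * p. *)
theory Submission imports Defs begin

section \<open>Concave functions on a compact interval\<close>

text \<open>The graph lies above the chord from \<open>z\<close> to \<open>e\<close>. Taking the
  slope in absolute value makes the bound the same on either side of \<open>z\<close>;
  \<open>e\<close> will be an endpoint of the interval.\<close>

lemma concave_on_lower_bound_towards:
  fixes f :: "real \<Rightarrow> real"
  assumes f: "concave_on S f" and "z \<in> S" "e \<in> S" "e \<noteq> z"
    and s: "0 \<le> s" "s \<le> 1" and y: "y = z + s * (e - z)"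
  shows "f z - \<bar>f e - f z\<bar> / \<bar>e - z\<bar> * \<bar>y - z\<bar> \<le> f y"
proof -
  have "(1 - s) * f z + s * f e \<le> f ((1 - s) * z + s * e)"
    using concave_onD[OF f s \<open>z \<in> S\<close> \<open>e \<in> S\<close>] by simp
  moreover have "(1 - s) * z + s * e = y"
    by (simp add: y algebra_simps)
  ultimately have "f z + s * (f e - f z) \<le> f y"
    by (simp add: algebra_simps)
  moreover have "- (s * \<bar>f e - f z\<bar>) \<le> s * (f e - f z)"
    using mult_left_mono[OF _ s(1), of "- \<bar>f e - f z\<bar>" "f e - f z"] by simp
  moreover have "\<bar>f e - f z\<bar> / \<bar>e - z\<bar> * \<bar>y - z\<bar> = s * \<bar>f e - f z\<bar>"
    using assms by (simp add: abs_mult)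
  ultimately show ?thesis
    by linarith
qed

lemma concave_on_interval_lower_bound:
  fixes f :: "real \<Rightarrow> real"
  assumes f: "concave_on {a..b} f" and z: "z \<in> {a..b}"
  obtains K where "K \<ge> 0" "\<And>y. y \<in> {a..b} \<Longrightarrow> f z - K * \<bar>y - z\<bar> \<le> f y"
proof -
  \<comment> \<open>If \<open>z\<close> is itself an endpoint, its slope is 0 / 0 = 0, so endpoints
    need no separate case. The sum of both slopes serves as \<open>K\<close> on either side of
    \<open>z\<close>.\<close>
  let ?k = "\<lambda>e. \<bar>f e - f z\<bar> / \<bar>e - z\<bar>"
  have nonneg: "?k a + ?k b \<ge> 0"
    by simp
  have weaken: "f z - (?k a + ?k b) * \<bar>y - z\<bar> \<le> f y"
    if "f z - ?k e * \<bar>y - z\<bar> \<le> f y" "e \<in> {a, b}" for e y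
  proof -
    have "?k e * \<bar>y - z\<bar> \<le> (?k a + ?k b) * \<bar>y - z\<bar>"
      using that(2) by (intro mult_right_mono) auto
    with that(1) show ?thesis by linarith
  qed
  have "f z - (?k a + ?k b) * \<bar>y - z\<bar> \<le> f y" if y: "y \<in> {a..b}" for y
  proof (cases y z rule: linorder_cases)
    case equal
    then show ?thesis by simp
  next
    case greater
    then show ?thesis
      using y z by (intro weaken[of b]
          concave_on_lower_bound_towards[OF f, where s = "(y - z) / (b - z)"]) auto
  next
    case less
    then show ?thesis
      using y z by (intro weaken[of a]
          concave_on_lower_bound_towards[OF f, where s = "(y - z) / (a - z)"])
        (auto simp: divide_simps)
  qed
  with nonneg show thesis
    by (rule that)
qed

text \<open>Concavity bounds \<open>f\<close> from below near \<open>z\<close>; the open complement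
  of a superlevel set bounds it from above. Closed superlevel sets exclude a downward jump at an
  endpoint, which concavity alone would allow.\<close>

lemma concave_on_interval_continuous_on:
  fixes f :: "real \<Rightarrow> real"
  assumes f: "concave_on {a..b} f" and usc: "\<And>c. closed {y \<in> {a..b}. c \<le> f y}"
  shows "continuous_on {a..b} f"
  unfolding continuous_on_iff
proof (intro ballI allI impI)
  fix z e :: real
  assume z: "z \<in> {a..b}" and e: "0 < e"
  obtain K where K: "K \<ge> 0" "\<And>y. y \<in> {a..b} \<Longrightarrow> f z - K * \<bar>y - z\<bar> \<le> f y"
    by (rule concave_on_interval_lower_bound[OF f z]) blast
  have "open (- {y \<in> {a..b}. f z + e \<le> f y})" "z \<in> - {y \<in> {a..b}. f z + e \<le> f y}"
    using usc e by auto
  then obtain d where d: "d > 0" "\<And>y. dist y z < d \<Longrightarrow> y \<in> - {y \<in> {a..b}. f z + e \<le> f y}"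
    unfolding open_dist by meson
  show "\<exists>d>0. \<forall>y\<in>{a..b}. dist y z < d \<longrightarrow> dist (f y) (f z) < e"
  \<comment> \<open>The divisor is \<open>K + 1\<close> because \<open>K\<close> may be 0.\<close>
  proof (intro exI[of _ "min d (e / (K + 1))"] conjI ballI impI)
    show "min d (e / (K + 1)) > 0"
      using d e K by simp
    fix y assume y: "y \<in> {a..b}" "dist y z < min d (e / (K + 1))"
    then have "f y < f z + e"
      using d(2)[of y] by auto
    moreover have "(K + 1) * \<bar>y - z\<bar> < e"
      using y(2) K(1) by (simp add: dist_real_def pos_less_divide_eq mult.commute)
    then have "K * \<bar>y - z\<bar> < e"
      by (simp add: algebra_simps)
    then have "f z - e < f y"
      using K(2)[OF y(1)] by linarith
    ultimately show "dist (f y) (f z) < e"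
      by (simp add: dist_real_def)
  qed
qed

section \<open>Trajectories and the objective series\<close>

locale ldo =
  fixes b :: real and p :: "nat \<Rightarrow> real" and \<Omega> :: "nat \<Rightarrow> (real \<times> real) set"
  assumes ldo: "LDO_problem b p \<Omega>"
begin

abbreviation "V \<equiv> opt_value b p \<Omega>"

text \<open>The start is left free: feasible sets are the slices \<open>x T = y\<close>, and
  superlevel sets of the value function are projections of subsets of this one compact set.\<close>

definition "trajectories T = {x \<in> {T..} \<rightarrow>\<^sub>E {0..b}. \<forall>t\<ge>T. (x t, x (Suc t)) \<in> \<Omega> t}"

lemma summable_abs_p: "summable (\<lambda>k. \<bar>p (T + k)\<bar>)"
  using ldo summable_iff_shift[of "\<lambda>t. \<bar>p t\<bar>" T] by (simp add: LDO_problem_def add.commute)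

lemma \<Omega>_in: "(x, y) \<in> \<Omega> t \<Longrightarrow> x \<in> {0..b} \<and> y \<in> {0..b}"
  using ldo unfolding LDO_problem_def by blast

lemma feasible_eq: "feasible b \<Omega> T y = {x \<in> trajectories T. x T = y}"
  by (auto simp: feasible_def trajectories_def)

lemma feasible_in: "x \<in> feasible b \<Omega> T y \<Longrightarrow> t \<ge> T \<Longrightarrow> x t \<in> {0..b}"
  by (auto simp: feasible_def dest!: PiE_mem[where x = t])

text \<open>The majorant does not depend on \<open>x\<close>, so it serves the comparison test, the
  M-test and the tail estimate alike.\<close>

lemma objective_term_bound:
  assumes "\<And>t. t \<ge> T \<Longrightarrow> x t \<in> {0..b}"
  shows "norm (p (T + k) * x (T + k)) \<le> b * \<bar>p (T + k)\<bar>"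
proof -
  have "\<bar>p (T + k)\<bar> * \<bar>x (T + k)\<bar> \<le> \<bar>p (T + k)\<bar> * b"
    using assms[of "T + k"] by (intro mult_left_mono) auto
  then show ?thesis
    by (simp add: abs_mult mult.commute)
qed

lemma summable_objective:
  assumes "\<And>t. t \<ge> T \<Longrightarrow> x t \<in> {0..b}"
  shows "summable (\<lambda>k. p (T + k) * x (T + k))"
  by (rule summable_comparison_test'[OF summable_mult[OF summable_abs_p]])
    (rule objective_term_bound[OF assms])

lemma objective_bound:
  assumes "\<And>t. t \<ge> T \<Longrightarrow> x t \<in> {0..b}"
  shows "\<bar>objective p T x\<bar> \<le> b * (\<Sum>k. \<bar>p (k + T)\<bar>)"
proof -
  have "norm (\<Sum>k. p (T + k) * x (T + k)) \<le> (\<Sum>k. b * \<bar>p (T + k)\<bar>)"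
    by (intro norm_suminf_le objective_term_bound[of T x] assms summable_mult summable_abs_p)
  also have "\<dots> = b * (\<Sum>k. \<bar>p (T + k)\<bar>)"
    by (rule suminf_mult[OF summable_abs_p])
  finally show ?thesis
    by (simp add: objective_def add.commute)
qed

lemma objective_Suc:
  assumes "\<And>t. t \<ge> T \<Longrightarrow> x t \<in> {0..b}"
  shows "objective p T x = p T * x T + objective p (Suc T) x"
  using suminf_split_head[OF summable_objective[of T x]] assms by (simp add: objective_def)

lemma objective_cong: "(\<And>t. t \<ge> T \<Longrightarrow> x t = y t) \<Longrightarrow> objective p T x = objective p T y"
  by (simp add: objective_def)

section \<open>Compactness and existence of maximizers\<close>

text \<open>Tychonoff's theorem gives a compact product; each constraint involves only two
  coordinates and hence cuts out a closed set.\<close>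

lemma compact_trajectories: "compact (trajectories T)"
proof -
  \<comment> \<open>Coordinates below \<open>T\<close> range over a compact singleton, which turns
    the extensional function space into a full product over all of \<open>nat\<close>.\<close>
  let ?C = "PiE UNIV (\<lambda>t. if t \<ge> T then {0..b} else {undefined :: real})"
  have C: "{T..} \<rightarrow>\<^sub>E {0..b} = ?C"
    by (force simp: PiE_def Pi_def extensional_def)
  have "compactin (product_topology (\<lambda>_. euclidean) UNIV) ?C"
    unfolding compactin_PiE by auto
  then have "compact ?C"
    by (simp add: euclidean_product_topology)
  moreover have "closed {x :: nat \<Rightarrow> real. t \<ge> T \<longrightarrow> (x t, x (Suc t)) \<in> \<Omega> t}" for t
  proof -
    have "closed ((\<lambda>x :: nat \<Rightarrow> real. (x t, x (Suc t))) -` \<Omega> t)"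
      using ldo by (intro closed_vimage) (auto simp: LDO_problem_def intro!: continuous_intros)
    then show ?thesis
      by (cases "t \<ge> T") (auto simp: vimage_def)
  qed
  then have "closed {x :: nat \<Rightarrow> real. \<forall>t\<ge>T. (x t, x (Suc t)) \<in> \<Omega> t}"
    by (rule closed_Collect_all)
  ultimately have "compact (?C \<inter> {x. \<forall>t\<ge>T. (x t, x (Suc t)) \<in> \<Omega> t})"
    by (rule compact_Int_closed)
  also have "?C \<inter> {x. \<forall>t\<ge>T. (x t, x (Suc t)) \<in> \<Omega> t} = trajectories T"
    by (auto simp: trajectories_def C)
  finally show ?thesis .
qed

text \<open>Partial sums depend on finitely many coordinates and so are continuous; the common
  majorant makes their convergence uniform.\<close>

lemma continuous_objective: "continuous_on (trajectories T) (objective p T)"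
proof (rule uniform_limit_theorem)
  have "uniform_limit (trajectories T) (\<lambda>n x. \<Sum>k<n. p (T + k) * x (T + k))
      (\<lambda>x. \<Sum>k. p (T + k) * x (T + k)) sequentially"
    using summable_mult[OF summable_abs_p]
    by (intro Weierstrass_m_test[where M = "\<lambda>k. b * \<bar>p (T + k)\<bar>"] objective_term_bound)
      (auto simp: trajectories_def PiE_def Pi_def)
  then show "uniform_limit (trajectories T) (\<lambda>n x. \<Sum>k<n. p (T + k) * x (T + k))
      (objective p T) sequentially"
    by (simp add: objective_def[abs_def])
qed (auto intro!: always_eventually continuous_intros
      continuous_on_subset[OF continuous_on_product_coordinates])

lemma feasible_nonempty:
  assumes "y \<in> {0..b}"
  shows "feasible b \<Omega> T y \<noteq> {}"
proof -
  have step: "\<exists>x'\<in>{0..b}. (x, x') \<in> \<Omega> (T + n)" if "x \<in> {0..b}" for x n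
    using ldo that unfolding LDO_problem_def by blast
  \<comment> \<open>The sequence is built from index 0 and shifted by \<open>T\<close> afterwards.
    The clause for \<open>n = 0\<close> carries the prescribed start inside the invariant of the
    choice principle.\<close>
  have "\<exists>x. \<forall>n. (x n \<in> {0..b} \<and> (n = 0 \<longrightarrow> x n = y)) \<and> (x n, x (Suc n)) \<in> \<Omega> (T + n)"
  proof (rule dependent_nat_choice)
    show "\<exists>x. x \<in> {0..b} \<and> (0 = 0 \<longrightarrow> x = y)"
      using assms by blast
    show "\<exists>x'. (x' \<in> {0..b} \<and> (Suc n = 0 \<longrightarrow> x' = y)) \<and> (x, x') \<in> \<Omega> (T + n)"
      if "x \<in> {0..b} \<and> (n = 0 \<longrightarrow> x = y)" for x n
      using step[of x n] that by blast
  qed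
  then obtain x where x: "x 0 = y" "\<And>n. x n \<in> {0..b} \<and> (x n, x (Suc n)) \<in> \<Omega> (T + n)"
    by blast
  have "(x (t - T), x (Suc t - T)) \<in> \<Omega> t" if "t \<ge> T" for t
    using x(2)[of "t - T"] that by (simp add: Suc_diff_le)
  then have "(\<lambda>t\<in>{T..}. x (t - T)) \<in> feasible b \<Omega> T y"
    unfolding feasible_def using x by (simp add: PiE_iff)
  then show ?thesis by blast
qed

lemma solution_exists:
  assumes "y \<in> {0..b}"
  obtains x where "x \<in> solutions b p \<Omega> T y"
proof -
  have "closed {x :: nat \<Rightarrow> real. x T = y}"
    by (intro closed_Collect_eq continuous_intros continuous_on_product_coordinates)
  then have "compact (trajectories T \<inter> {x. x T = y})"
    by (rule compact_Int_closed[OF compact_trajectories])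
  then have "compact (feasible b \<Omega> T y)"
    by (simp add: feasible_eq Int_def)
  moreover have "continuous_on (feasible b \<Omega> T y) (objective p T)"
    by (rule continuous_on_subset[OF continuous_objective]) (auto simp: feasible_eq)
  ultimately obtain x where "x \<in> feasible b \<Omega> T y"
    "\<And>w. w \<in> feasible b \<Omega> T y \<Longrightarrow> objective p T w \<le> objective p T x"
    using continuous_attains_sup[OF _ feasible_nonempty[OF assms]] by blast
  then show ?thesis
    by (intro that[of x]) (auto simp: solutions_def is_arg_max_linorder)
qed

section \<open>Concavity and continuity of the value function\<close>

text \<open>Two maximizers dominate each other, so the definite description in
  \<open>opt_value\<close> is proper and can be avoided from here on.\<close>

lemma objective_solution:
  assumes "x \<in> solutions b p \<Omega> T y"
  shows "objective p T x = V T y"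
proof -
  have "objective p T w = objective p T x" if "w \<in> solutions b p \<Omega> T y" for w
    using assms that by (intro antisym) (simp_all add: solutions_def is_arg_max_linorder)
  then show ?thesis
    unfolding opt_value_def using assms by (intro the_equality[symmetric]) blast+
qed

lemma objective_le_V:
  assumes "x \<in> feasible b \<Omega> T y"
  shows "objective p T x \<le> V T y"
proof -
  have "y \<in> {0..b}"
    using feasible_in[OF assms, of T] assms by (auto simp: feasible_def)
  then obtain w where "w \<in> solutions b p \<Omega> T y"
    by (rule solution_exists)
  then show ?thesis
    using assms objective_solution[of w T y] by (simp add: solutions_def is_arg_max_linorder)
qed

lemma solutions_iff:
  "x \<in> solutions b p \<Omega> T y \<longleftrightarrow> x \<in> feasible b \<Omega> T y \<and> objective p T x = V T y"
  using objective_solution[of x T y] objective_le_V[of _ T y]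
  by (auto simp: solutions_def is_arg_max_linorder)

lemma V_attained:
  assumes "y \<in> {0..b}"
  obtains x where "x \<in> feasible b \<Omega> T y" "objective p T x = V T y"
  by (rule solution_exists[OF assms, of T]) (auto simp: solutions_iff intro: that)

lemma feasible_convex:
  assumes x: "x \<in> feasible b \<Omega> T y" and x': "x' \<in> feasible b \<Omega> T y'"
    and u: "u \<ge> 0" "v \<ge> 0" "u + v = 1"
  shows "(\<lambda>t\<in>{T..}. u * x t + v * x' t) \<in> feasible b \<Omega> T (u * y + v * y')"
proof -
  have "(u * x t + v * x' t, u * x (Suc t) + v * x' (Suc t)) \<in> \<Omega> t" if "t \<ge> T" for t
  proof -
    have "convex (\<Omega> t)"
      using ldo by (auto simp: LDO_problem_def)
    then have "u *\<^sub>R (x t, x (Suc t)) + v *\<^sub>R (x' t, x' (Suc t)) \<in> \<Omega> t"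
      using x x' u that by (intro convexD) (auto simp: feasible_def)
    then show ?thesis by simp
  qed
  \<comment> \<open>The bounds are read off from \<Omega> t being a subset of the square.\<close>
  moreover from this have "u * x t + v * x' t \<in> {0..b}" if "t \<ge> T" for t
    using \<Omega>_in that by blast
  ultimately show ?thesis
    using x x' by (simp add: feasible_def)
qed

text \<open>A convex combination of maximizers from \<open>y\<close> and \<open>y'\<close> competes
  from the combined start, and its objective is the same combination of the optimal values.\<close>

lemma concave_V: "concave_on {0..b} (V T)"
  unfolding concave_on_iff
proof (intro conjI ballI allI impI)
  fix y y' u v :: real
  assume y: "y \<in> {0..b}" and y': "y' \<in> {0..b}" and u: "u \<ge> 0" "v \<ge> 0" "u + v = 1"
  obtain x where x: "x \<in> feasible b \<Omega> T y" "objective p T x = V T y"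
    by (rule V_attained[OF y])
  obtain x' where x': "x' \<in> feasible b \<Omega> T y'" "objective p T x' = V T y'"
    by (rule V_attained[OF y'])
  have s: "summable (\<lambda>k. p (T + k) * x (T + k))" "summable (\<lambda>k. p (T + k) * x' (T + k))"
    using x x' by (auto intro!: summable_objective dest: feasible_in)
  have "u * V T y + v * V T y' =
      (\<Sum>k. u * (p (T + k) * x (T + k)) + v * (p (T + k) * x' (T + k)))"
    using s unfolding x(2)[symmetric] x'(2)[symmetric] objective_def
    by (simp add: suminf_add[symmetric] suminf_mult summable_mult)
  also have "\<dots> = objective p T (\<lambda>t\<in>{T..}. u * x t + v * x' t)"
    by (simp add: objective_def algebra_simps)
  also have "\<dots> \<le> V T (u * y + v * y')"
    by (rule objective_le_V[OF feasible_convex[OF x(1) x'(1) u]])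
  finally show "u * V T y + v * V T y' \<le> V T (u *\<^sub>R y + v *\<^sub>R y')"
    by simp
qed simp

lemma continuous_V: "continuous_on {0..b} (V T)"
proof (rule concave_on_interval_continuous_on[OF concave_V])
  fix c
  let ?F = "{x \<in> trajectories T. objective p T x \<in> {c..}}"
  have "compact ?F"
    using continuous_closedin_preimage[OF continuous_objective closed_atLeast]
    by (intro closedin_compact[OF compact_trajectories]) (simp add: vimage_def Int_def)
  then have "compact ((\<lambda>x. x T) ` ?F)"
    by (intro compact_continuous_image continuous_on_subset[OF continuous_on_product_coordinates])
      auto
  \<comment> \<open>The inclusion from right to left rests on the optimal value being attained: the
    maximizer itself lies in \<open>?F\<close>.\<close>
  moreover have "(\<lambda>x. x T) ` ?F = {y \<in> {0..b}. c \<le> V T y}"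
  proof (intro equalityI subsetI)
    fix y assume "y \<in> (\<lambda>x. x T) ` ?F"
    then obtain x where x: "x \<in> feasible b \<Omega> T y" "c \<le> objective p T x"
      by (auto simp: feasible_eq)
    then show "y \<in> {y \<in> {0..b}. c \<le> V T y}"
      using objective_le_V[OF x(1)] feasible_in[OF x(1), of T] by (auto simp: feasible_def)
  next
    fix y assume y: "y \<in> {y \<in> {0..b}. c \<le> V T y}"
    then obtain x where "x \<in> solutions b p \<Omega> T y"
      using solution_exists by blast
    then show "y \<in> (\<lambda>x. x T) ` ?F"
      using y by (auto simp: solutions_iff feasible_eq intro!: image_eqI[of _ _ x])
  qed
  ultimately show "closed {y \<in> {0..b}. c \<le> V T y}"
    by (simp add: compact_imp_closed)
qed

section \<open>The functional equation\<close>

lemma feasible_tail: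
  assumes "x \<in> feasible b \<Omega> T y"
  shows "restrict x {Suc T..} \<in> feasible b \<Omega> (Suc T) (x (Suc T))"
  using assms by (auto simp: feasible_def PiE_iff)

text \<open>Only the \<open>undefined\<close> entry at \<open>T\<close> is overwritten, so the
  result is extensional over \<open>{T..}\<close>.\<close>

lemma feasible_prepend:
  assumes "x \<in> feasible b \<Omega> (Suc T) y" "(z, y) \<in> \<Omega> T"
  shows "x(T := z) \<in> feasible b \<Omega> T z"
proof -
  have "(x(T := z)) t \<in> {0..b}" if "t \<ge> T" for t
    using feasible_in[OF assms(1), of t] \<Omega>_in[OF assms(2)] that by auto
  moreover have "x t = undefined" if "t < T" for t
    using assms(1) that by (auto simp: feasible_def PiE_def extensional_def)
  ultimately show ?thesis
    using assms by (auto simp: feasible_def PiE_def extensional_def)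
qed

text \<open>Prepending \<open>z\<close> to an optimal trajectory from \<open>y\<close> yields a
  competitor from \<open>z\<close>.\<close>

lemma V_ge_step:
  assumes "(z, y) \<in> \<Omega> T"
  shows "p T * z + V (Suc T) y \<le> V T z"
proof -
  obtain x where x: "x \<in> feasible b \<Omega> (Suc T) y" "objective p (Suc T) x = V (Suc T) y"
    using V_attained \<Omega>_in[OF assms] by blast
  note x' = feasible_prepend[OF x(1) assms]
  have "objective p T (x(T := z)) = p T * z + objective p (Suc T) (x(T := z))"
    using objective_Suc[of T "x(T := z)"] feasible_in[OF x'] by simp
  also have "objective p (Suc T) (x(T := z)) = V (Suc T) y"
    unfolding x(2)[symmetric] by (rule objective_cong) simp
  finally show ?thesis
    using objective_le_V[OF x'] by linarith
qed

text \<open>Principle of optimality: the tail is a competitor at time \<open>Suc T\<close>, which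
  gives one inequality, and \<open>V_ge_step\<close> gives the other. Equality then forces the tail
  to be optimal.\<close>

lemma solution_step:
  assumes "x \<in> solutions b p \<Omega> T z"
  shows "V T z = p T * z + V (Suc T) (x (Suc T))"
    and "restrict x {Suc T..} \<in> solutions b p \<Omega> (Suc T) (x (Suc T))"
proof -
  have x: "x \<in> feasible b \<Omega> T z" "objective p T x = V T z"
    using assms by (auto simp: solutions_iff)
  then have xz: "x T = z" "(z, x (Suc T)) \<in> \<Omega> T"
    by (auto simp: feasible_def)
  note tail = feasible_tail[OF x(1)]
  have eq: "objective p (Suc T) (restrict x {Suc T..}) = objective p (Suc T) x"
    by (rule objective_cong) simp
  have V: "V T z = p T * z + objective p (Suc T) x"
    using objective_Suc[of T x] feasible_in[OF x(1)] x(2) xz(1) by simp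
  then show *: "V T z = p T * z + V (Suc T) (x (Suc T))"
    using V_ge_step[OF xz(2)] objective_le_V[OF tail] eq by linarith
  show "restrict x {Suc T..} \<in> solutions b p \<Omega> (Suc T) (x (Suc T))"
    using tail V * eq by (simp add: solutions_iff)
qed

text \<open>Iterates the principle of optimality; the restriction discards the entries before
  \<open>T\<close> to match the extensional encoding.\<close>

lemma solution_tail:
  assumes "x \<in> solutions b p \<Omega> 0 y"
  shows "restrict x {T..} \<in> solutions b p \<Omega> T (x T)"
proof (induction T)
  case 0
  have "x 0 = y"
    using assms by (simp add: solutions_iff feasible_def)
  then show ?case
    using assms by (simp add: restrict_def)
next
  case (Suc T)
  have "restrict (restrict x {T..}) {Suc T..} = restrict x {Suc T..}"
    by auto
  moreover have "restrict x {T..} (Suc T) = x (Suc T)"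
    by simp
  ultimately show ?case
    using solution_step(2)[OF Suc] by (simp only:)
qed

section \<open>Solutions characterized by the functional equation\<close>

text \<open>Each value is the objective of some trajectory starting at time \<open>T\<close>, hence
  at most a tail of a convergent series in absolute value.\<close>

lemma V_tendsto_0:
  assumes "\<And>T. x T \<in> {0..b}"
  shows "(\<lambda>T. V T (x T)) \<longlonglongrightarrow> 0"
proof (rule Lim_null_comparison)
  have "\<bar>V T (x T)\<bar> \<le> b * (\<Sum>k. \<bar>p (k + T)\<bar>)" for T
  proof (rule V_attained[OF assms, of T T])
    fix w assume w: "w \<in> feasible b \<Omega> T (x T)" "objective p T w = V T (x T)"
    show ?thesis
      using objective_bound[of T w] feasible_in[OF w(1)] by (simp only: w(2))
  qed
  then show "\<forall>\<^sub>F T in sequentially. norm (V T (x T)) \<le> b * (\<Sum>k. \<bar>p (k + T)\<bar>)"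
    by simp
  have "(\<lambda>T. \<Sum>k. \<bar>p (k + T)\<bar>) \<longlonglongrightarrow> 0"
    using summable_abs_p[of 0] by (intro suminf_exist_split2) simp
  then show "(\<lambda>T. b * (\<Sum>k. \<bar>p (k + T)\<bar>)) \<longlonglongrightarrow> 0"
    by (rule tendsto_mult_right_zero)
qed

text \<open>The partial sums telescope to \<open>V 0 (x 0) - V T (x T)\<close>, whose last term
  vanishes in the limit, so \<open>x\<close> attains the optimal value.\<close>

lemma solution_if_bellman:
  assumes x: "x \<in> feasible b \<Omega> 0 y"
    and step: "\<And>T. V T (x T) = p T * x T + V (Suc T) (x (Suc T))"
  shows "x \<in> solutions b p \<Omega> 0 y"
proof -
  have in_X: "x t \<in> {0..b}" for t
    using feasible_in[OF x] by simp
  have "(\<Sum>t<T. p t * x t) = V 0 (x 0) - V T (x T)" for T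
  proof (induction T)
    case (Suc T)
    then show ?case
      using step[of T] by simp
  qed simp
  moreover have "(\<lambda>T. V 0 (x 0) - V T (x T)) \<longlonglongrightarrow> V 0 (x 0) - 0"
    by (intro tendsto_intros V_tendsto_0 in_X)
  ultimately have "(\<lambda>t. p t * x t) sums V 0 (x 0)"
    by (simp add: sums_def)
  then have "objective p 0 x = V 0 (x 0)"
    by (simp add: objective_def sums_iff)
  moreover have "x 0 = y"
    using x by (simp add: feasible_def)
  ultimately show ?thesis
    using x by (simp add: solutions_iff)
qed

text \<open>Shows that the maximum in the functional equation exists: \<open>V_ge_step\<close>
  bounds every candidate by \<open>V T z\<close>, and the successor chosen by \<open>x\<close>
  reaches this bound.\<close>

lemma V_step_arg_max:
  assumes "x \<in> solutions b p \<Omega> T z"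
  shows "is_arg_max (V (Suc T)) (\<lambda>y. y \<in> \<Omega> T `` {z}) (x (Suc T))"
proof -
  have "(z, x (Suc T)) \<in> \<Omega> T"
    using assms by (auto simp: solutions_iff feasible_def)
  moreover have "V (Suc T) y \<le> V (Suc T) (x (Suc T))" if "(z, y) \<in> \<Omega> T" for y
    using V_ge_step[OF that] solution_step(1)[OF assms] by linarith
  ultimately show ?thesis
    by (auto simp: is_arg_max_linorder)
qed

lemma solutions_iff_bellman:
  "x \<in> solutions b p \<Omega> 0 y \<longleftrightarrow> x \<in> feasible b \<Omega> 0 y \<and>
    (\<forall>T. V T (x T) = p T * x T + V (Suc T) (x (Suc T)))"
proof (intro iffI conjI allI)
  assume x: "x \<in> solutions b p \<Omega> 0 y"
  then show "x \<in> feasible b \<Omega> 0 y"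
    by (simp add: solutions_iff)
  show "V T (x T) = p T * x T + V (Suc T) (x (Suc T))" for T
    \<comment> \<open>The restricted tail agrees with \<open>x\<close> at \<open>T\<close> and
      \<open>Suc T\<close>, the only entries in the equation.\<close>
    using solution_step(1)[OF solution_tail[OF x, of T]] by simp
qed (blast intro: solution_if_bellman)

end

theorem proposition4p1:
  fixes b :: real
    and p :: "nat \<Rightarrow> real"
    and \<Omega> :: "nat \<Rightarrow> (real \<times> real) set"
  assumes "b > 0"
    and "LDO_problem b p \<Omega>"
  shows "(concave_on {0..b} (opt_value b p \<Omega> 0) \<and> continuous_on {0..b} (opt_value b p \<Omega> 0)) \<and>
    (\<forall>T. concave_on {0..b} (opt_value b p \<Omega> T) \<and> continuous_on {0..b} (opt_value b p \<Omega> T) \<and>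
       (\<forall>z\<in>{0..b}. \<forall>x\<in>solutions b p \<Omega> T z.
          opt_value b p \<Omega> T z = p T * z + opt_value b p \<Omega> (Suc T) (x (Suc T)) \<and>
          (\<exists>y. is_arg_max (opt_value b p \<Omega> (Suc T)) (\<lambda>y. y \<in> \<Omega> T `` {z}) y \<and>
               opt_value b p \<Omega> T z = p T * z + opt_value b p \<Omega> (Suc T) y))) \<and>
    (\<forall>x\<in>{0..b}. \<forall>xs :: nat \<Rightarrow> real.
       xs \<in> solutions b p \<Omega> 0 x \<longleftrightarrow>
       xs \<in> feasible b \<Omega> 0 x \<and>
       (\<forall>T. opt_value b p \<Omega> T (xs T) = p T * xs T + opt_value b p \<Omega> (Suc T) (xs (Suc T))))"
proof -
  interpret ldo b p \<Omega>
    using assms(2) by unfold_locales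
  show ?thesis
    using concave_V continuous_V solution_step(1) V_step_arg_max solutions_iff_bellman by blast
qed

end
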